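(* Let $(X,d)$ be a compact metric space and $f_{1,\infty}=\{f_i\}_{i=1}^\infty$ a sequence of continuous self-maps of $X$. Then for any $Z\subseteq X$, with closure $\overline Z$, and any $\theta\in(0,1]$, \[ \underline{h}_{\mathrm{top}}(f_{1,\infty},\overline{Z},\theta)=\underline{h}_{\mathrm{top}}(f_{1,\infty},Z,\theta),\qquad \overline{h}_{\mathrm{top}}(f_{1,\infty},\overline{Z},\theta)=\overline{h}_{\mathrm{top}}(f_{1,\infty},Z,\theta). \]
   Context: Intermediate topological entropies. Let $X$ be a compact topological space and $f_{1,\infty}=\{f_i\}_{i=1}^\infty$ a sequence of continuous maps $X\to X$. Put $f_i^0=\mathrm{id}_X$ and $f_i^j=f_{i+j-1}\circ\cdots\circ f_{i+1}\circ f_i$ for $j\ge1$. For a finite open cover $\mathcal U$ of $X$ and $m\in\mathbb N=\{1,2,\dots\}$, a string of length $m(\mathbf U)=m$ is an element $\mathbf U=(U_0,\dots,U_{m-1})\in\mathcal S_m(\mathcal U):=\mathcal U^m$, and $X(\mathbf U)=\{x\in X: f_1^j(x)\in U_j,\ 0\le j\le m-1\}$. For $Z\subseteq X$, $\alpha\ge0$, $\theta\in[0,1]$, $N\in\mathbb N$ let \[ M(Z,\alpha,\mathcal U,N,\theta)=\inf_{\mathcal G}\sum_{\mathbf U\in\mathcal G}e^{-\alpha m(\mathbf U)}, \] the infimum over all finite or countable collections $\mathcal G\subseteq\bigcup_{N\le m<N/\theta+1}\mathcal S_m(\mathcal U)$ with $Z\subseteq\bigcup_{\mathbf U\in\mathcal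 G}X(\mathbf U)$ (for $\theta=0$, $N/\theta=+\infty$). Let $\underline m(Z,\alpha,\mathcal U,\theta)=\liminf_{N\to\infty}M(Z,\alpha,\mathcal U,N,\theta)$ and $\overline m(Z,\alpha,\mathcal U,\theta)=\limsup_{N\to\infty}M(Z,\alpha,\mathcal U,N,\theta)$. Set $\underline h_{\mathrm{top}}(f_{1,\infty},Z,\mathcal U,\theta)=\inf\{\alpha\ge0:\underline m(Z,\alpha,\mathcal U,\theta)=0\}$, $\overline h_{\mathrm{top}}(f_{1,\infty},Z,\mathcal U,\theta)=\inf\{\alpha\ge0:\overline m(Z,\alpha,\mathcal U,\theta)=0\}$. The lower and upper $\theta$-intermediate topological entropies $\underline h_{\mathrm{top}}(f_{1,\infty},Z,\theta)$ and $\overline h_{\mathrm{top}}(f_{1,\infty},Z,\theta)$, with values in $[0,\infty]$, are the suprema of these quantities over all finite open covers $\mathcal U$ of $X$. *)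

theory Defs
  imports "HOL-Analysis.Analysis"
begin

text \<open>
  The space is an abstract topology \<open>X\<close>. A sequence of maps is a function \<open>f\<close> on \<^typ>\<open>nat\<close> of
  which only the values at indices \<open>i \<ge> 1\<close> are used. Entropies take values in \<^typ>\<open>ennreal\<close>.
\<close>

primrec seq_iterate :: "(nat \<Rightarrow> 'a \<Rightarrow> 'a) \<Rightarrow> nat \<Rightarrow> nat \<Rightarrow> 'a \<Rightarrow> 'a" where
  "seq_iterate f i 0 = id"
| "seq_iterate f i (Suc j) = f (i + j) \<circ> seq_iterate f i j"

definition finite_open_cover :: "'a topology \<Rightarrow> 'a set set \<Rightarrow> bool" where
  "finite_open_cover X \<U> \<longleftrightarrow>
     finite \<U> \<and> (\<forall>U\<in>\<U>. openin X U) \<and> \<Union>\<U> = topspace X"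

definition strings :: "'a set set \<Rightarrow> nat \<Rightarrow> 'a set list set" where
  "strings \<U> m = {S. length S = m \<and> set S \<subseteq> \<U>}"

definition string_set :: "'a topology \<Rightarrow> (nat \<Rightarrow> 'a \<Rightarrow> 'a) \<Rightarrow> 'a set list \<Rightarrow> 'a set" where
  "string_set X f S = {x \<in> topspace X. \<forall>j<length S. seq_iterate f 1 j x \<in> S ! j}"

text \<open>For \<open>\<theta> = 0\<close> the upper bound \<open>N / \<theta> + 1\<close> is infinite, whereas division by zero in
  \<^typ>\<open>real\<close> yields zero; hence the case distinction.\<close>

definition string_lengths :: "nat \<Rightarrow> real \<Rightarrow> nat set" where
  "string_lengths N \<theta> = {m. N \<le> m \<and> (\<theta> = 0 \<or> real m < real N / \<theta> + 1)}"

definition covering_families ::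
  "'a topology \<Rightarrow> (nat \<Rightarrow> 'a \<Rightarrow> 'a) \<Rightarrow> 'a set \<Rightarrow> 'a set set \<Rightarrow> nat \<Rightarrow> real \<Rightarrow> 'a set list set set" where
  "covering_families X f Z \<U> N \<theta> =
     {\<G>. countable \<G> \<and> \<G> \<subseteq> (\<Union>m\<in>string_lengths N \<theta>. strings \<U> m)
          \<and> Z \<subseteq> (\<Union>S\<in>\<G>. string_set X f S)}"

definition cover_sum ::
  "'a topology \<Rightarrow> (nat \<Rightarrow> 'a \<Rightarrow> 'a) \<Rightarrow> 'a set \<Rightarrow> real \<Rightarrow> 'a set set \<Rightarrow> nat \<Rightarrow> real \<Rightarrow> ennreal" where
  "cover_sum X f Z \<alpha> \<U> N \<theta> =
     (INF \<G>\<in>covering_families X f Z \<U> N \<theta>.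
        \<Sum>\<^sub>\<infinity>S\<in>\<G>. ennreal (exp (- \<alpha> * real (length S))))"

definition lower_m ::
  "'a topology \<Rightarrow> (nat \<Rightarrow> 'a \<Rightarrow> 'a) \<Rightarrow> 'a set \<Rightarrow> real \<Rightarrow> 'a set set \<Rightarrow> real \<Rightarrow> ennreal" where
  "lower_m X f Z \<alpha> \<U> \<theta> = liminf (\<lambda>N. cover_sum X f Z \<alpha> \<U> N \<theta>)"

definition upper_m ::
  "'a topology \<Rightarrow> (nat \<Rightarrow> 'a \<Rightarrow> 'a) \<Rightarrow> 'a set \<Rightarrow> real \<Rightarrow> 'a set set \<Rightarrow> real \<Rightarrow> ennreal" where
  "upper_m X f Z \<alpha> \<U> \<theta> = limsup (\<lambda>N. cover_sum X f Z \<alpha> \<U> N \<theta>)"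

definition lower_entropy_cover ::
  "'a topology \<Rightarrow> (nat \<Rightarrow> 'a \<Rightarrow> 'a) \<Rightarrow> 'a set \<Rightarrow> 'a set set \<Rightarrow> real \<Rightarrow> ennreal" where
  "lower_entropy_cover X f Z \<U> \<theta> =
     Inf {ennreal \<alpha> | \<alpha>. 0 \<le> \<alpha> \<and> lower_m X f Z \<alpha> \<U> \<theta> = 0}"

definition upper_entropy_cover ::
  "'a topology \<Rightarrow> (nat \<Rightarrow> 'a \<Rightarrow> 'a) \<Rightarrow> 'a set \<Rightarrow> 'a set set \<Rightarrow> real \<Rightarrow> ennreal" where
  "upper_entropy_cover X f Z \<U> \<theta> =
     Inf {ennreal \<alpha> | \<alpha>. 0 \<le> \<alpha> \<and> upper_m X f Z \<alpha> \<U> \<theta> = 0}"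

definition lower_entropy ::
  "'a topology \<Rightarrow> (nat \<Rightarrow> 'a \<Rightarrow> 'a) \<Rightarrow> 'a set \<Rightarrow> real \<Rightarrow> ennreal" where
  "lower_entropy X f Z \<theta> =
     (SUP \<U>\<in>{\<U>. finite_open_cover X \<U>}. lower_entropy_cover X f Z \<U> \<theta>)"

definition upper_entropy ::
  "'a topology \<Rightarrow> (nat \<Rightarrow> 'a \<Rightarrow> 'a) \<Rightarrow> 'a set \<Rightarrow> real \<Rightarrow> ennreal" where
  "upper_entropy X f Z \<theta> =
     (SUP \<U>\<in>{\<U>. finite_open_cover X \<U>}. upper_entropy_cover X f Z \<U> \<theta>)"

end

theory Submission
  imports Defs
begin

text \<open>
  Since \<open>X\<close> is compact and regular, every finite open cover \<open>\<U>\<close> has a finite open refinement \<open>\<V>\<close>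
  in which the closure of each member lies in a member of \<open>\<U>\<close>. For \<open>\<theta> > 0\<close> the string lengths
  are bounded, so a family of \<open>\<V>\<close>-strings is finite, and the closure of the union of its string sets
  is the union of their closures. Replacing each letter of a \<open>\<V>\<close>-string by a member of \<open>\<U>\<close>
  containing its closure turns a family covering \<open>Z\<close> into one covering the closure of \<open>Z\<close>, without
  changing lengths. Hence the entropy of the closure with respect to \<open>\<U>\<close> is at most that of \<open>Z\<close> with
  respect to \<open>\<V>\<close>; the other inequality is monotonicity in \<open>Z\<close>.
\<close>

text \<open>Regularity shrinks a member of \<open>\<U>\<close> around each point so that the closure
  stays inside it, and compactness leaves finitely many of the shrunk sets. The choice
  \<open>c\<close> is made explicit because it is later applied letter by letter to strings.\<close>

lemma finite_open_cover_closure_refinement: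
  assumes "compact_space X" "regular_space X" "finite_open_cover X \<U>"
  obtains \<V> c where "finite_open_cover X \<V>"
    "\<And>V. V \<in> \<V> \<Longrightarrow> c V \<in> \<U> \<and> X closure_of V \<subseteq> c V"
proof -
  define \<W> where "\<W> = {W. openin X W \<and> (\<exists>U\<in>\<U>. X closure_of W \<subseteq> U)}"
  have "\<exists>W\<in>\<W>. x \<in> W" if x: "x \<in> topspace X" for x
  proof -
    obtain U where U: "U \<in> \<U>" "x \<in> U" "openin X U"
      using assms(3) x by (auto simp: finite_open_cover_def)
    \<comment> \<open>In a regular space the closed neighbourhoods form a base; the closure of
      \<open>W\<close> is then trapped in the closed set \<open>C\<close>.\<close>
    obtain W C where "openin X W" "closedin X C" "x \<in> W" "W \<subseteq> C" "C \<subseteq> U"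
      using assms(2) U unfolding neighbourhood_base_of_closedin [symmetric] neighbourhood_base_of
      by metis
    moreover from this have "X closure_of W \<subseteq> U"
      using closure_of_minimal by (metis order_trans)
    ultimately show ?thesis
      using U(1) by (auto simp: \<W>_def)
  qed
  then have "topspace X \<subseteq> \<Union>\<W>"
    by blast
  moreover have "\<forall>W\<in>\<W>. openin X W"
    by (simp add: \<W>_def)
  ultimately obtain \<V> where \<V>: "finite \<V>" "\<V> \<subseteq> \<W>" "topspace X \<subseteq> \<Union>\<V>"
    using assms(1) unfolding compact_space_alt by meson
  have "finite_open_cover X \<V>"
    unfolding finite_open_cover_def
  proof (intro conjI ballI antisym)
    show open_V: "openin X V" if "V \<in> \<V>" for V
      using \<V>(2) that by (auto simp: \<W>_def)
    show "\<Union>\<V> \<subseteq> topspace X"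
      using open_V openin_subset by blast
  qed (use \<V> in auto)
  moreover obtain c where "\<And>V. V \<in> \<V> \<Longrightarrow> c V \<in> \<U> \<and> X closure_of V \<subseteq> c V"
    using bchoice [of \<V> "\<lambda>V U. U \<in> \<U> \<and> X closure_of V \<subseteq> U"] \<V>(2) unfolding \<W>_def by blast
  ultimately show ?thesis
    using that by blast
qed

lemma continuous_map_seq_iterate:
  assumes "\<And>i. 1 \<le> i \<Longrightarrow> continuous_map X X (f i)" "1 \<le> i"
  shows "continuous_map X X (seq_iterate f i j)"
proof (induction j)
  case (Suc j)
  then show ?case
    using continuous_map_compose [OF Suc assms(1) [of "i + j"]] assms(2) by (simp add: o_def)
qed simp

text \<open>The j-th iterate maps the string set into \<open>S ! j\<close>, so by continuity it maps
  the closure of the string set into the closure of \<open>S ! j\<close>, hence into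
  \<open>c (S ! j)\<close>.\<close>

lemma closure_of_string_set_subset:
  assumes cont: "\<And>i. 1 \<le> i \<Longrightarrow> continuous_map X X (f i)"
    and c: "\<And>V. V \<in> set S \<Longrightarrow> X closure_of V \<subseteq> c V"
  shows "X closure_of string_set X f S \<subseteq> string_set X f (map c S)"
proof
  fix x assume x: "x \<in> X closure_of string_set X f S"
  have "seq_iterate f 1 j x \<in> c (S ! j)" if j: "j < length S" for j
  proof -
    have "seq_iterate f 1 j x \<in> X closure_of (seq_iterate f 1 j ` string_set X f S)"
      using continuous_map_image_closure_subset [OF continuous_map_seq_iterate [of X f, OF cont]] x
      by blast
    also have "\<dots> \<subseteq> X closure_of (S ! j)"
      using j by (intro closure_of_mono) (auto simp: string_set_def)
    finally show ?thesis
      using c j by (meson nth_mem subsetD)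
  qed
  then show "x \<in> string_set X f (map c S)"
    using x closure_of_subset_topspace by (fastforce simp: string_set_def)
qed

lemma finite_string_lengths:
  assumes "0 < \<theta>"
  shows "finite (string_lengths N \<theta>)"
proof (rule finite_subset)
  show "string_lengths N \<theta> \<subseteq> {..nat \<lceil>real N / \<theta> + 1\<rceil>}"
    using assms unfolding string_lengths_def by (auto simp: le_nat_iff; linarith)
qed simp

lemma finite_covering_family:
  assumes "0 < \<theta>" "finite \<U>" "\<G> \<in> covering_families X f Z \<U> N \<theta>"
  shows "finite \<G>"
proof (rule finite_subset)
  show "\<G> \<subseteq> (\<Union>m\<in>string_lengths N \<theta>. strings \<U> m)"
    using assms(3) by (simp add: covering_families_def)
  show "finite (\<Union>m\<in>string_lengths N \<theta>. strings \<U> m)"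
    using finite_string_lengths [OF assms(1)] finite_lists_length_eq [OF assms(2)]
    by (simp add: strings_def conj_commute)
qed

lemma covering_families_closure_of:
  assumes cont: "\<And>i. 1 \<le> i \<Longrightarrow> continuous_map X X (f i)"
    and c: "\<And>V. V \<in> \<V> \<Longrightarrow> c V \<in> \<U> \<and> X closure_of V \<subseteq> c V"
    and "finite \<G>" and \<G>: "\<G> \<in> covering_families X f Z \<V> N \<theta>"
  shows "map c ` \<G> \<in> covering_families X f (X closure_of Z) \<U> N \<theta>"
proof -
  have letters: "set S \<subseteq> \<V>" if "S \<in> \<G>" for S
    using \<G> that by (auto simp: covering_families_def strings_def)
  have "map c ` \<G> \<subseteq> (\<Union>m\<in>string_lengths N \<theta>. strings \<U> m)"
    using \<G> c by (fastforce simp: covering_families_def strings_def)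
  moreover have "X closure_of Z \<subseteq> (\<Union>S\<in>map c ` \<G>. string_set X f S)"
  proof -
    have "X closure_of Z \<subseteq> X closure_of (\<Union>S\<in>\<G>. string_set X f S)"
      using \<G> by (intro closure_of_mono) (simp add: covering_families_def)
    \<comment> \<open>Closure commutes with finite unions, but not with countable ones in
      general.\<close>
    also have "\<dots> = (\<Union>S\<in>\<G>. X closure_of string_set X f S)"
      using \<open>finite \<G>\<close> by (simp add: closure_of_Union)
    also have "\<dots> \<subseteq> (\<Union>S\<in>\<G>. string_set X f (map c S))"
      using letters c by (intro UN_mono order_refl closure_of_string_set_subset [OF cont]) blast+
    finally show ?thesis
      by simp
  qed
  ultimately show ?thesis
    using \<open>finite \<G>\<close> by (simp add: covering_families_def countable_finite)
qed

lemma cover_sum_closure_of_le: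
  assumes "\<And>i. 1 \<le> i \<Longrightarrow> continuous_map X X (f i)" "0 < \<theta>" "finite \<V>"
    and "\<And>V. V \<in> \<V> \<Longrightarrow> c V \<in> \<U> \<and> X closure_of V \<subseteq> c V"
  shows "cover_sum X f (X closure_of Z) \<alpha> \<U> N \<theta> \<le> cover_sum X f Z \<alpha> \<V> N \<theta>"
  unfolding cover_sum_def
proof (rule INF_mono)
  fix \<G> assume \<G>: "\<G> \<in> covering_families X f Z \<V> N \<theta>"
  let ?w = "\<lambda>S :: 'a set list. ennreal (exp (- \<alpha> * real (length S)))"
  have fin: "finite \<G>"
    using finite_covering_family assms(2,3) \<G> by blast
  \<comment> \<open>\<open>map c\<close> preserves lengths and thus weights, but it may identify
    different strings; merging them can only lower the sum.\<close>
  then have "infsum ?w (map c ` \<G>) \<le> infsum ?w \<G>"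
    using sum_image_le [OF fin, of ?w "map c"] by (simp add: o_def)
  then show "\<exists>\<G>'\<in>covering_families X f (X closure_of Z) \<U> N \<theta>. infsum ?w \<G>' \<le> infsum ?w \<G>"
    using covering_families_closure_of [OF assms(1,4) fin \<G>] by blast
qed

lemma cover_sum_mono:
  assumes "Z \<subseteq> Z'"
  shows "cover_sum X f Z \<alpha> \<U> N \<theta> \<le> cover_sum X f Z' \<alpha> \<U> N \<theta>"
  unfolding cover_sum_def
  by (rule INF_superset_mono) (use assms in \<open>auto simp: covering_families_def\<close>)

text \<open>Smaller sums vanish in the limit for more exponents \<alpha>, and the infimum over a
  larger set is smaller. The covers on the two sides may differ, as the passage to the closure
  replaces \<open>\<U>\<close> by a refinement.\<close>

lemma entropy_cover_mono:
  assumes "\<And>\<alpha> N. cover_sum X f Z \<alpha> \<U> N \<theta> \<le> cover_sum X f Z' \<alpha> \<V> N \<theta>"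
  shows "lower_entropy_cover X f Z \<U> \<theta> \<le> lower_entropy_cover X f Z' \<V> \<theta>"
    and "upper_entropy_cover X f Z \<U> \<theta> \<le> upper_entropy_cover X f Z' \<V> \<theta>"
proof -
  have "lower_m X f Z \<alpha> \<U> \<theta> \<le> lower_m X f Z' \<alpha> \<V> \<theta>"
    and "upper_m X f Z \<alpha> \<U> \<theta> \<le> upper_m X f Z' \<alpha> \<V> \<theta>" for \<alpha>
    unfolding lower_m_def upper_m_def using assms by (auto intro: Liminf_mono Limsup_mono)
  then have "lower_m X f Z' \<alpha> \<V> \<theta> = 0 \<Longrightarrow> lower_m X f Z \<alpha> \<U> \<theta> = 0"
    and "upper_m X f Z' \<alpha> \<V> \<theta> = 0 \<Longrightarrow> upper_m X f Z \<alpha> \<U> \<theta> = 0" for \<alpha>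
    by (metis le_zero_eq)+
  then show "lower_entropy_cover X f Z \<U> \<theta> \<le> lower_entropy_cover X f Z' \<V> \<theta>"
    and "upper_entropy_cover X f Z \<U> \<theta> \<le> upper_entropy_cover X f Z' \<V> \<theta>"
    unfolding lower_entropy_cover_def upper_entropy_cover_def
    by (auto intro!: Inf_superset_mono)
qed

lemma entropy_mono:
  assumes "Z \<subseteq> Z'"
  shows "lower_entropy X f Z \<theta> \<le> lower_entropy X f Z' \<theta>"
    and "upper_entropy X f Z \<theta> \<le> upper_entropy X f Z' \<theta>"
  unfolding lower_entropy_def upper_entropy_def
  by (intro SUP_mono' entropy_cover_mono cover_sum_mono assms)+

lemma entropy_closure_of_le:
  assumes "compact_space X" "regular_space X"
    and "\<And>i. 1 \<le> i \<Longrightarrow> continuous_map X X (f i)" "0 < \<theta>"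
  shows "lower_entropy X f (X closure_of Z) \<theta> \<le> lower_entropy X f Z \<theta>"
    and "upper_entropy X f (X closure_of Z) \<theta> \<le> upper_entropy X f Z \<theta>"
proof -
  \<comment> \<open>One refinement of \<open>\<U>\<close> serves both entropies; the suprema over
    covers are then compared term by term.\<close>
  have *: "\<exists>\<V>\<in>{\<V>. finite_open_cover X \<V>}.
        lower_entropy_cover X f (X closure_of Z) \<U> \<theta> \<le> lower_entropy_cover X f Z \<V> \<theta>
      \<and> upper_entropy_cover X f (X closure_of Z) \<U> \<theta> \<le> upper_entropy_cover X f Z \<V> \<theta>"
    if "finite_open_cover X \<U>" for \<U>
  proof -
    obtain \<V> c where \<V>: "finite_open_cover X \<V>"
      and c: "\<And>V. V \<in> \<V> \<Longrightarrow> c V \<in> \<U> \<and> X closure_of V \<subseteq> c V"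
      using finite_open_cover_closure_refinement [OF assms(1,2) \<open>finite_open_cover X \<U>\<close>] by blast
    have "cover_sum X f (X closure_of Z) \<alpha> \<U> N \<theta> \<le> cover_sum X f Z \<alpha> \<V> N \<theta>" for \<alpha> N
      using \<V> by (intro cover_sum_closure_of_le [OF assms(3,4) _ c]) (simp_all add: finite_open_cover_def)
    then show ?thesis
      using \<V> entropy_cover_mono by blast
  qed
  show "lower_entropy X f (X closure_of Z) \<theta> \<le> lower_entropy X f Z \<theta>"
    unfolding lower_entropy_def by (rule SUP_mono) (use * in blast)
  show "upper_entropy X f (X closure_of Z) \<theta> \<le> upper_entropy X f Z \<theta>"
    unfolding upper_entropy_def by (rule SUP_mono) (use * in blast)
qed

theorem proposition3p1:
  fixes X :: "'a set" and d :: "'a \<Rightarrow> 'a \<Rightarrow> real"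
    and f :: "nat \<Rightarrow> 'a \<Rightarrow> 'a" and Z :: "'a set" and \<theta> :: real
  assumes "Metric_space X d"
    and "compact_space (Metric_space.mtopology X d)"
    and "\<And>i. 1 \<le> i \<Longrightarrow>
           continuous_map (Metric_space.mtopology X d) (Metric_space.mtopology X d) (f i)"
    and "Z \<subseteq> X"
    and "0 < \<theta>" and "\<theta> \<le> 1"
  shows "lower_entropy (Metric_space.mtopology X d) f (Metric_space.mtopology X d closure_of Z) \<theta>
           = lower_entropy (Metric_space.mtopology X d) f Z \<theta>
       \<and> upper_entropy (Metric_space.mtopology X d) f (Metric_space.mtopology X d closure_of Z) \<theta>
           = upper_entropy (Metric_space.mtopology X d) f Z \<theta>"
proof -
  let ?T = "Metric_space.mtopology X d"
  have "regular_space ?T"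
    by (simp add: Metric_space.regular_space_mtopology assms(1))
  then have "lower_entropy ?T f (?T closure_of Z) \<theta> \<le> lower_entropy ?T f Z \<theta>"
    and "upper_entropy ?T f (?T closure_of Z) \<theta> \<le> upper_entropy ?T f Z \<theta>"
    using entropy_closure_of_le assms(2,3,5) by blast+
  \<comment> \<open>\<open>closure_of\<close> only contains points of the space, so this inclusion
    rests on Z being a subset of X.\<close>
  moreover have "Z \<subseteq> ?T closure_of Z"
    by (simp add: assms(1,4) Metric_space.topspace_mtopology closure_of_subset)
  ultimately show ?thesis
    using entropy_mono by (metis antisym)
qed

end
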